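(* Let $\mathcal A$ be an almost-$\Gamma$-like collection of sets and $\mathcal B$ a $\Gamma$-like collection of sets. Then $\alpha_2(\mathcal A,\mathcal B)$ holds if and only if Player I does not have a predetermined winning strategy in the game $G_1(\mathcal A,\mathcal B)$.
   Context: A collection $\mathcal B$ of sets is $\Gamma$-like if every $B\in\mathcal B$ is infinite and every infinite subset of $B$ also belongs to $\mathcal B$. A collection $\mathcal A$ of sets is almost-$\Gamma$-like if for each $A\in\mathcal A$ there is $A'\subseteq A$ with $|A'|=\aleph_0$ such that every cofinite subset $A''$ of $A'$ belongs to $\mathcal A$. $\alpha_2(\mathcal A,\mathcal B)$ is the statement: whenever $A_n\in\mathcal A$ for all $n<\omega$, there exists $B\in\mathcal B$ such that $A_n\cap B$ is infinite for all $n<\omega$. The game $G_1(\mathcal A,\mathcal B)$ has length $\omega$: during round $n<\omega$, Player I chooses $A_n\in\mathcal A$, then Player II chooses $a_n\in A_n$. Player II wins if $\{a_n:n<\omega\}\in\mathcal B$, and Player I wins otherwise. A strategy is predetermined if it relies only on the round number and ignores the opponent's moves (so for Player I it is a sequence $(A_n)_{n<\omega}$ of members of $\mathcal A$); it is winning if it defeats every possible counterplay by the opponent. *)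

theory Defs
  imports "HOL-Library.Countable_Set"
begin

definition Gamma_like :: "'a set set \<Rightarrow> bool" where
  "Gamma_like \<B> \<longleftrightarrow> (\<forall>B\<in>\<B>. infinite B \<and> (\<forall>C. C \<subseteq> B \<and> infinite C \<longrightarrow> C \<in> \<B>))"

definition almost_Gamma_like :: "'a set set \<Rightarrow> bool" where
  "almost_Gamma_like \<A> \<longleftrightarrow>
     (\<forall>A\<in>\<A>. \<exists>A'. A' \<subseteq> A \<and> countable A' \<and> infinite A' \<and>
        (\<forall>A''. A'' \<subseteq> A' \<and> finite (A' - A'') \<longrightarrow> A'' \<in> \<A>))"

definition alpha2 :: "'a set set \<Rightarrow> 'a set set \<Rightarrow> bool" where
  "alpha2 \<A> \<B> \<longleftrightarrow>
     (\<forall>A :: nat \<Rightarrow> 'a set. (\<forall>n. A n \<in> \<A>) \<longrightarrow> (\<exists>B\<in>\<B>. \<forall>n. infinite (A n \<inter> B)))"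

text \<open>
  A strategy for Player I in the selection game maps the list of Player II's previous
  moves, in order of play, to Player I's next move; Player I's own previous moves are
  determined by the strategy and need not be recorded.  The length of the list is the
  number of the current round.
\<close>

type_synonym 'a strategy_I = "'a list \<Rightarrow> 'a set"

definition is_strategy_I :: "'a set set \<Rightarrow> 'a strategy_I \<Rightarrow> bool" where
  "is_strategy_I \<A> \<sigma> \<longleftrightarrow> (\<forall>xs. \<sigma> xs \<in> \<A>)"

definition predetermined_I :: "'a strategy_I \<Rightarrow> bool" where
  "predetermined_I \<sigma> \<longleftrightarrow> (\<forall>xs ys. length xs = length ys \<longrightarrow> \<sigma> xs = \<sigma> ys)"

definition legal_counterplay_II :: "'a strategy_I \<Rightarrow> (nat \<Rightarrow> 'a) \<Rightarrow> bool" where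
  "legal_counterplay_II \<sigma> a \<longleftrightarrow> (\<forall>n. a n \<in> \<sigma> (map a [0..<n]))"

definition II_wins_G1 :: "'a set set \<Rightarrow> (nat \<Rightarrow> 'a) \<Rightarrow> bool" where
  "II_wins_G1 \<B> a \<longleftrightarrow> range a \<in> \<B>"

definition winning_strategy_I_G1 :: "'a set set \<Rightarrow> 'a set set \<Rightarrow> 'a strategy_I \<Rightarrow> bool" where
  "winning_strategy_I_G1 \<A> \<B> \<sigma> \<longleftrightarrow>
     is_strategy_I \<A> \<sigma> \<and> (\<forall>a. legal_counterplay_II \<sigma> a \<longrightarrow> \<not> II_wins_G1 \<B> a)"

definition I_has_predetermined_winning_strategy_G1 :: "'a set set \<Rightarrow> 'a set set \<Rightarrow> bool" where
  "I_has_predetermined_winning_strategy_G1 \<A> \<B> \<longleftrightarrow>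
     (\<exists>\<sigma>. predetermined_I \<sigma> \<and> winning_strategy_I_G1 \<A> \<B> \<sigma>)"

end

theory Submission
  imports Defs
begin

text \<open>
  A predetermined strategy for Player I is a sequence of members of \<open>\<A>\<close>, and it fails exactly
  when some choice of one point from each term has its range in \<open>\<B>\<close>
  (\<open>no_predetermined_winning_strategy_iff\<close>).  So the theorem compares two selection principles:
  picking infinitely many points from every term of a sequence, all within one member of \<open>\<B>\<close>,
  and picking just one point from every term.

  If \<open>B \<in> \<B>\<close> meets every \<open>A n\<close> in an infinite set, then pairwise distinct points
  \<open>a n \<in> A n \<inter> B\<close> can be chosen (\<open>infinite_sets_distinct_choice\<close>).  Their range is an infinite
  subset of \<open>B\<close> and therefore belongs to \<open>\<B>\<close>, since \<open>\<B>\<close> is \<open>\<Gamma>\<close>-like.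

  Conversely, infinitely many points of each \<open>A n\<close> come from single-point choices by letting each
  \<open>A n\<close> appear in infinitely many rounds.  Repeating \<open>A n\<close> itself would allow the same point to be
  picked every time, so the rounds devoted to \<open>n\<close> offer instead the tails of an enumeration of
  the countably infinite set \<open>A' \<subseteq> A n\<close> provided by the almost-\<open>\<Gamma>\<close>-like property.  Tails are
  cofinite in \<open>A'\<close>, hence in \<open>\<A>\<close>, and a set that meets every tail of an injective enumeration
  contains infinitely many of its terms (\<open>infinite_if_meets_all_tails\<close>).
\<close>

lemma no_predetermined_winning_strategy_iff:
  "\<not> I_has_predetermined_winning_strategy_G1 \<A> \<B> \<longleftrightarrow>
     (\<forall>A :: nat \<Rightarrow> 'a set. (\<forall>n. A n \<in> \<A>) \<longrightarrow> (\<exists>a. (\<forall>n. a n \<in> A n) \<and> range a \<in> \<B>))"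
  (is "?L \<longleftrightarrow> ?R")
proof
  assume L: ?L
  show ?R
  proof (intro allI impI)
    fix A :: "nat \<Rightarrow> 'a set"
    assume "\<forall>n. A n \<in> \<A>"
    moreover have "predetermined_I (\<lambda>xs. A (length xs))"
      by (simp add: predetermined_I_def)
    ultimately show "\<exists>a. (\<forall>n. a n \<in> A n) \<and> range a \<in> \<B>"
      using L
      unfolding I_has_predetermined_winning_strategy_G1_def winning_strategy_I_G1_def
        is_strategy_I_def legal_counterplay_II_def II_wins_G1_def
      by fastforce
  qed
next
  assume R: ?R
  show ?L
  proof
    assume "I_has_predetermined_winning_strategy_G1 \<A> \<B>"
    then obtain \<sigma> where pre: "predetermined_I \<sigma>" and strat: "\<And>xs. \<sigma> xs \<in> \<A>"
      and win: "\<And>a. legal_counterplay_II \<sigma> a \<Longrightarrow> range a \<notin> \<B>"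
      by (auto simp: I_has_predetermined_winning_strategy_G1_def winning_strategy_I_G1_def
          is_strategy_I_def II_wins_G1_def)
    \<comment> \<open>Only the length of the history matters, so any history of length \<open>n\<close> yields round \<open>n\<close>'s set.\<close>
    obtain a where a: "\<And>n. a n \<in> \<sigma> (replicate n undefined)" and "range a \<in> \<B>"
      using R[rule_format, of "\<lambda>n. \<sigma> (replicate n undefined)"] strat by blast
    have "\<sigma> (map a [0..<n]) = \<sigma> (replicate n undefined)" for n
      using pre unfolding predetermined_I_def by simp
    then have "legal_counterplay_II \<sigma> a"
      using a by (simp add: legal_counterplay_II_def)
    with win \<open>range a \<in> \<B>\<close> show False by blast
  qed
qed

text \<open>
  Only finitely many points are used up before stage \<open>n\<close>, so the infinite set \<open>S n\<close> always has
  a fresh one.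
\<close>

lemma infinite_sets_distinct_choice:
  fixes S :: "nat \<Rightarrow> 'a set"
  assumes "\<And>n. infinite (S n)"
  shows "\<exists>a. inj a \<and> (\<forall>n. a n \<in> S n)"
proof -
  have "\<exists>a. \<forall>n. a n \<in> S n - a ` {..<n}"
  proof (rule dependent_wellorder_choice)
    fix r :: 'a and f g :: "nat \<Rightarrow> 'a" and n
    assume "\<And>m. m < n \<Longrightarrow> f m = g m"
    then have "f ` {..<n} = g ` {..<n}" by (intro image_cong) auto
    then show "(r \<in> S n - f ` {..<n}) = (r \<in> S n - g ` {..<n})" by simp
  next
    fix n and f :: "nat \<Rightarrow> 'a"
    have "infinite (S n - f ` {..<n})"
      using assms by (simp add: Diff_infinite_finite)
    then show "\<exists>r. r \<in> S n - f ` {..<n}"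
      using infinite_imp_nonempty by blast
  qed
  then obtain a where a: "\<And>n. a n \<in> S n - a ` {..<n}" by blast
  have "inj a"
  proof (rule linorder_injI)
    fix m n :: nat
    assume "m < n"
    then show "a m \<noteq> a n" using a[of n] by (metis DiffD2 image_eqI lessThan_iff)
  qed
  with a show ?thesis by blast
qed

lemma infinite_if_meets_all_tails:
  fixes e :: "nat \<Rightarrow> 'a"
  assumes "inj e" and "\<And>m. \<exists>x\<in>B. x \<in> e ` {m..}"
  shows "infinite (range e \<inter> B)"
proof -
  have "\<forall>m. \<exists>j\<ge>m. j \<in> e -` B"
    using assms(2) by fastforce
  then have "infinite (e -` B)"
    by (simp add: infinite_nat_iff_unbounded_le)
  then have "infinite (e ` (e -` B))"
    using \<open>inj e\<close> by (metis finite_imageD inj_on_subset subset_UNIV)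
  then show ?thesis
    by (simp add: image_vimage_eq Int_commute)
qed

lemma almost_Gamma_like_tails:
  assumes "almost_Gamma_like \<A>" and "A \<in> \<A>"
  shows "\<exists>e :: nat \<Rightarrow> 'a. inj e \<and> range e \<subseteq> A \<and> (\<forall>m. e ` {m..} \<in> \<A>)"
proof -
  obtain A' where A': "A' \<subseteq> A" "countable A'" "infinite A'"
    and cofin: "\<And>A''. A'' \<subseteq> A' \<Longrightarrow> finite (A' - A'') \<Longrightarrow> A'' \<in> \<A>"
    using assms unfolding almost_Gamma_like_def by meson
  define e where "e = from_nat_into A'"
  have e: "bij_betw e UNIV A'"
    unfolding e_def using A' by (simp add: bij_betw_from_nat_into)
  have "e ` {m..} \<in> \<A>" for m
  proof (rule cofin)
    show "e ` {m..} \<subseteq> A'"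
      using e by (auto simp: bij_betw_def)
    have "A' - e ` {m..} \<subseteq> e ` {..<m}"
      using e by (force simp: bij_betw_def)
    then show "finite (A' - e ` {m..})"
      by (rule finite_subset) simp
  qed
  with e A' show ?thesis by (auto simp: bij_betw_def)
qed

theorem theorem8:
  fixes \<A> \<B> :: "'a set set"
  assumes "almost_Gamma_like \<A>" and "Gamma_like \<B>"
  shows "alpha2 \<A> \<B> \<longleftrightarrow> \<not> I_has_predetermined_winning_strategy_G1 \<A> \<B>"
  unfolding no_predetermined_winning_strategy_iff
proof (intro iffI allI impI)
  fix A :: "nat \<Rightarrow> 'a set"
  assume "alpha2 \<A> \<B>" and "\<forall>n. A n \<in> \<A>"
  then obtain B where "B \<in> \<B>" and "\<And>n. infinite (A n \<inter> B)"
    unfolding alpha2_def by blast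
  then obtain a where "inj a" and a: "\<And>n. a n \<in> A n \<inter> B"
    using infinite_sets_distinct_choice[of "\<lambda>n. A n \<inter> B"] by blast
  from \<open>inj a\<close> have "infinite (range a)"
    by (rule range_inj_infinite)
  moreover have "range a \<subseteq> B" using a by blast
  ultimately have "range a \<in> \<B>"
    using \<open>Gamma_like \<B>\<close> \<open>B \<in> \<B>\<close> unfolding Gamma_like_def by blast
  with a show "\<exists>a. (\<forall>n. a n \<in> A n) \<and> range a \<in> \<B>" by blast
next
  assume select: "\<forall>A :: nat \<Rightarrow> 'a set. (\<forall>n. A n \<in> \<A>) \<longrightarrow>
    (\<exists>a. (\<forall>n. a n \<in> A n) \<and> range a \<in> \<B>)"
  show "alpha2 \<A> \<B>"
    unfolding alpha2_def
  proof (intro allI impI)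
    fix A :: "nat \<Rightarrow> 'a set"
    assume "\<forall>n. A n \<in> \<A>"
    then have "\<forall>n. \<exists>e :: nat \<Rightarrow> 'a. inj e \<and> range e \<subseteq> A n \<and> (\<forall>m. e ` {m..} \<in> \<A>)"
      using almost_Gamma_like_tails[OF assms(1)] by blast
    then obtain e :: "nat \<Rightarrow> nat \<Rightarrow> 'a" where inj: "\<And>n. inj (e n)"
      and sub: "\<And>n. range (e n) \<subseteq> A n" and tail: "\<And>n m. e n ` {m..} \<in> \<A>"
      by metis
    \<comment> \<open>The round coded by \<open>(n, m)\<close> offers the tail of the enumeration \<open>e n\<close> that starts at \<open>m\<close>.\<close>
    define T where "T k = (case from_nat k of (n, m) \<Rightarrow> e n ` {m..})" for k :: nat
    have "\<forall>k. T k \<in> \<A>"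
      using tail by (simp add: T_def split: prod.split)
    then obtain a where a: "\<And>k. a k \<in> T k" and "range a \<in> \<B>"
      using select by blast
    have "infinite (A n \<inter> range a)" for n
    proof -
      have "a (to_nat (n, m)) \<in> e n ` {m..}" for m
        using a[of "to_nat (n, m)"] by (simp add: T_def)
      then have "infinite (range (e n) \<inter> range a)"
        using inj by (intro infinite_if_meets_all_tails) blast+
      moreover have "range (e n) \<inter> range a \<subseteq> A n \<inter> range a"
        using sub by blast
      ultimately show ?thesis
        using infinite_super by blast
    qed
    with \<open>range a \<in> \<B>\<close> show "\<exists>B\<in>\<B>. \<forall>n. infinite (A n \<inter> B)" by blast
  qed
qed

end
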